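(* Let $n\ge 2$ be an integer, let $l>0$ and $0<m<n$ be real numbers, and let $f:(0,l)\to\mathbb{R}$ be a positive, strictly convex function. Let $\theta_1,\dots,\theta_n\in(0,l)$ satisfy $\sum_{i=1}^n\theta_i=ml$, and put $\sigma=\frac1n\sum_{i=1}^n\theta_i=\frac{ml}{n}$. Then for every positive integer $\alpha$, $$\left(\sum_{i=1}^{n}f(\theta_i)\right)^{2\alpha}-\left(nf(\sigma)\right)^\alpha\left(\sum_{i=1}^{n}f(\theta_i)\right)^\alpha\geq\left(f(\sigma)\right)^\alpha\left[\left(\sum_{i=1}^{n}f(\theta_i)\right)^\alpha-\left(nf(\sigma)\right)^\alpha\right],$$ and equality holds if and only if $\theta_1=\theta_2=\cdots=\theta_n=\sigma$. *)

theory Defs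
  imports "HOL-Analysis.Analysis"
begin

(* Strict analogue of convex_on: the inequality is required only for two distinct points
   and a weight strictly between 0 and 1. *)
definition strictly_convex_on :: "'a::real_vector set \<Rightarrow> ('a \<Rightarrow> real) \<Rightarrow> bool"
  where "strictly_convex_on S f \<longleftrightarrow>
    convex S \<and>
    (\<forall>x\<in>S. \<forall>y\<in>S. \<forall>u>0. \<forall>v>0. x \<noteq> y \<longrightarrow> u + v = 1 \<longrightarrow>
      f (u *\<^sub>R x + v *\<^sub>R y) < u * f x + v * f y)"

end

theory Submission
  imports Defs
begin

text \<open>
  With \<open>A = (\<Sum>f(\<theta>\<^sub>i))\<^sup>\<alpha>\<close>, \<open>B = (n f(\<sigma>))\<^sup>\<alpha>\<close> and \<open>C = f(\<sigma>)\<^sup>\<alpha>\<close> the difference of the two sides is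
  \<open>(A - B)(A - C)\<close>. Jensen's inequality gives \<open>A \<ge> B > C\<close>, so the product is nonnegative and vanishes
  exactly in the equality case of Jensen's inequality.
\<close>

lemma strictly_convex_on_imp_convex_on:
  assumes "strictly_convex_on S f"
  shows "convex_on S f"
proof (rule convex_onI)
  show "convex S"
    using assms by (simp add: strictly_convex_on_def)
next
  fix t x y
  assume t: "0 < t" "t < (1::real)" and xy: "x \<in> S" "y \<in> S"
  show "f ((1 - t) *\<^sub>R x + t *\<^sub>R y) \<le> (1 - t) * f x + t * f y"
  \<comment> \<open>Strict convexity says nothing about coinciding points; there both sides equal
    \<open>f x\<close>.\<close>
  proof (cases "x = y")
    case True
    then show ?thesis
      by (simp add: algebra_simps)
  next
    case False
    have "f ((1 - t) *\<^sub>R x + t *\<^sub>R y) < (1 - t) * f x + t * f y"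
      using assms t xy False unfolding strictly_convex_on_def by auto
    then show ?thesis
      by simp
  qed
qed

text \<open>Splitting off a point that differs from the mean leaves a proper two-point combination, to
  which strict convexity applies; ordinary Jensen handles the remaining points.\<close>

lemma strictly_convex_on_sum_less:
  fixes y :: "'i \<Rightarrow> 'a::real_vector"
  assumes fin: "finite I" and f: "strictly_convex_on S f"
    and sum1: "(\<Sum>i\<in>I. a i) = 1" and pos: "\<And>i. i \<in> I \<Longrightarrow> a i > 0"
    and y: "\<And>i. i \<in> I \<Longrightarrow> y i \<in> S"
    and k: "k \<in> I" "y k \<noteq> (\<Sum>i\<in>I. a i *\<^sub>R y i)"
  shows "f (\<Sum>i\<in>I. a i *\<^sub>R y i) < (\<Sum>i\<in>I. a i * f (y i))"
proof -
  define J where "J = I - {k}"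
  define w where "w = 1 - a k"
  have split: "sum g I = g k + sum g J" for g :: "'i \<Rightarrow> 'b::comm_monoid_add"
    using fin k(1) unfolding J_def by (simp add: sum.remove)
  have J: "finite J" "J \<subseteq> I"
    using fin by (auto simp: J_def)
  have w_sum: "w = sum a J"
    using split[of a] sum1 by (simp add: w_def)
  \<comment> \<open>If \<open>k\<close> were the only index, its weight would be 1 and the mean
    would be \<open>y k\<close> itself. Nonemptiness makes \<open>w\<close> positive, so the
    remaining weights can be renormalised.\<close>
  have "J \<noteq> {}"
  proof
    assume "J = {}"
    then have "a k = 1" "(\<Sum>i\<in>I. a i *\<^sub>R y i) = a k *\<^sub>R y k"
      using w_sum split[of "\<lambda>i. a i *\<^sub>R y i"] by (simp_all add: w_def)
    then show False
      using k(2) by simp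
  qed
  then have w: "w > 0"
    unfolding w_sum using J pos by (intro sum_pos) auto
  \<comment> \<open>The barycentre of the remaining points, their weights divided by
    \<open>w\<close> so that they sum to 1.\<close>
  define z where "z = (\<Sum>i\<in>J. (a i / w) *\<^sub>R y i)"
  have weights: "(\<Sum>i\<in>J. a i / w) = 1" "\<And>i. i \<in> J \<Longrightarrow> 0 \<le> a i / w"
    using w w_sum J pos by (auto simp flip: sum_divide_distrib intro!: divide_nonneg_pos less_imp_le)
  have conv: "convex_on S f"
    using f by (rule strictly_convex_on_imp_convex_on)
  have zS: "z \<in> S"
    unfolding z_def using J weights y convex_on_imp_convex[OF conv]
    by (intro convex_sum) auto
  have wz: "w *\<^sub>R z = (\<Sum>i\<in>J. a i *\<^sub>R y i)"
    using w by (simp add: z_def scaleR_sum_right)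
  have mean: "(\<Sum>i\<in>I. a i *\<^sub>R y i) = a k *\<^sub>R y k + w *\<^sub>R z"
    using split[of "\<lambda>i. a i *\<^sub>R y i"] wz by simp
  \<comment> \<open>Since \<open>a k + w = 1\<close>, the equality \<open>y k = z\<close> would make
    the whole mean equal to \<open>y k\<close>.\<close>
  have "y k \<noteq> z"
    using k(2) mean by (auto simp: w_def simp flip: scaleR_add_left)
  then have "f (\<Sum>i\<in>I. a i *\<^sub>R y i) < a k * f (y k) + w * f z"
    unfolding mean using f zS y[OF k(1)] pos[OF k(1)] w
    by (auto simp: strictly_convex_on_def w_def)
  also have "f z \<le> (\<Sum>i\<in>J. a i / w * f (y i))"
    unfolding z_def using J weights y \<open>J \<noteq> {}\<close> by (intro convex_on_sum[OF _ _ conv]) auto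
  then have "w * f z \<le> w * (\<Sum>i\<in>J. a i / w * f (y i))"
    using w by simp
  also have "\<dots> = (\<Sum>i\<in>J. a i * f (y i))"
    using w by (simp add: sum_distrib_left)
  also have "a k * f (y k) + \<dots> = (\<Sum>i\<in>I. a i * f (y i))"
    using split[of "\<lambda>i. a i * f (y i)"] by simp
  finally show ?thesis
    by simp
qed

theorem theorem1:
  fixes n \<alpha> :: nat and l m \<sigma> :: real
    and f :: "real \<Rightarrow> real" and \<theta> :: "nat \<Rightarrow> real"
  assumes "n \<ge> 2"
    and "l > 0"
    and "0 < m" and "m < real n"
    and "\<And>x. x \<in> {0<..<l} \<Longrightarrow> f x > 0"
    and "strictly_convex_on {0<..<l} f"
    and "\<And>i. i \<in> {1..n} \<Longrightarrow> \<theta> i \<in> {0<..<l}"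
    and "(\<Sum>i=1..n. \<theta> i) = m * l"
    and "\<sigma> = (1 / real n) * (\<Sum>i=1..n. \<theta> i)"
    and "\<alpha> \<ge> 1"
  shows "(\<Sum>i=1..n. f (\<theta> i)) ^ (2 * \<alpha>) - (real n * f \<sigma>) ^ \<alpha> * (\<Sum>i=1..n. f (\<theta> i)) ^ \<alpha>
           \<ge> (f \<sigma>) ^ \<alpha> * ((\<Sum>i=1..n. f (\<theta> i)) ^ \<alpha> - (real n * f \<sigma>) ^ \<alpha>)
       \<and> ((\<Sum>i=1..n. f (\<theta> i)) ^ (2 * \<alpha>) - (real n * f \<sigma>) ^ \<alpha> * (\<Sum>i=1..n. f (\<theta> i)) ^ \<alpha>
            = (f \<sigma>) ^ \<alpha> * ((\<Sum>i=1..n. f (\<theta> i)) ^ \<alpha> - (real n * f \<sigma>) ^ \<alpha>)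
          \<longleftrightarrow> (\<forall>i\<in>{1..n}. \<theta> i = \<sigma>))"
proof -
  define s where "s = (\<Sum>i=1..n. f (\<theta> i))"
  define A where "A = s ^ \<alpha>"
  define B where "B = (real n * f \<sigma>) ^ \<alpha>"
  define C where "C = f \<sigma> ^ \<alpha>"
  have n: "real n > 1"
    using assms(1) by simp
  have "\<sigma> = m * l / real n"
    using assms(8,9) by simp
  \<comment> \<open>The bound \<open>m < real n\<close> is what keeps the mean below
    \<open>l\<close>.\<close>
  then have "0 < \<sigma>" "\<sigma> < l"
    using n assms(2-4) by (simp_all add: pos_divide_less_eq)
  then have f\<sigma>: "f \<sigma> > 0"
    using assms(5) by simp
  have mean: "(\<Sum>i=1..n. (1 / real n) *\<^sub>R \<theta> i) = \<sigma>"
    by (simp add: assms(9) sum_divide_distrib)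
  \<comment> \<open>Jensen with equal weights \<open>1 / real n\<close>: a single point off the mean
    already forces strictness. Together with \<open>const\<close> this settles both the inequality
    and its equality case.\<close>
  have strict: "real n * f \<sigma> < s" if "k \<in> {1..n}" "\<theta> k \<noteq> \<sigma>" for k
  proof -
    have "f (\<Sum>i=1..n. (1 / real n) *\<^sub>R \<theta> i) < (\<Sum>i=1..n. 1 / real n * f (\<theta> i))"
      using that mean n by (intro strictly_convex_on_sum_less[OF _ assms(6) _ _ assms(7)]) auto
    also have "\<dots> = s / real n"
      by (simp add: s_def sum_divide_distrib)
    finally show ?thesis
      unfolding mean using n by (simp add: field_simps)
  qed
  have const: "s = real n * f \<sigma>" if "\<forall>i\<in>{1..n}. \<theta> i = \<sigma>"
    using that by (simp add: s_def)
  have le: "real n * f \<sigma> \<le> s"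
    using strict const by fastforce
  have n_gt: "f \<sigma> < real n * f \<sigma>"
    using n f\<sigma> by simp
  have s_eq_iff: "s = real n * f \<sigma> \<longleftrightarrow> (\<forall>i\<in>{1..n}. \<theta> i = \<sigma>)"
    using strict const by fastforce
  have AB: "A \<ge> B"
    unfolding A_def B_def using le f\<sigma> by (intro power_mono) auto
  have BC: "B > C"
    unfolding B_def C_def using n_gt f\<sigma> assms(10) by (intro power_strict_mono) auto
  \<comment> \<open>Powers with exponent \<alpha> \<ge> 1 are injective on nonnegative
    bases.\<close>
  have AB_eq: "A = B \<longleftrightarrow> s = real n * f \<sigma>"
    unfolding A_def B_def using le n_gt f\<sigma> assms(10) by (intro power_eq_iff_eq_base) linarith+
  have "s ^ (2 * \<alpha>) = A * A"
    by (simp add: A_def mult_2 power_add)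
  then have diff: "(s ^ (2 * \<alpha>) - B * A) - C * (A - B) = (A - B) * (A - C)"
    by (simp add: algebra_simps)
  have "(A - B) * (A - C) \<ge> 0"
    using AB BC by simp
  \<comment> \<open>\<open>A \<ge> B > C\<close> makes \<open>A - C\<close> positive, so only
    \<open>A - B\<close> can vanish.\<close>
  moreover have "(A - B) * (A - C) = 0 \<longleftrightarrow> (\<forall>i\<in>{1..n}. \<theta> i = \<sigma>)"
    using AB BC AB_eq s_eq_iff by auto
  ultimately have "s ^ (2 * \<alpha>) - B * A \<ge> C * (A - B) \<and>
      (s ^ (2 * \<alpha>) - B * A = C * (A - B) \<longleftrightarrow> (\<forall>i\<in>{1..n}. \<theta> i = \<sigma>))"
    using diff by linarith
  then show ?thesis
    unfolding A_def B_def C_def s_def .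
qed

end
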